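(* Let $A\in\mathbb{R}^{m\times n}$, $b\in\mathbb{R}^m$, $\lambda>0$, and let $\bar x\in\mathbb{R}^n$ be a solution of the problem $\min_{x\in\mathbb{R}^n}\|Ax-b\|+\lambda\|x\|_1$. Put $I:=\operatorname{supp}(\bar x)$ and suppose that: (i) $\ker A_I=\{0\}$ and $b\notin\operatorname{rge}A_I$; (ii) there exists $z\in\left\{\frac{b-A\bar x}{\|A\bar x-b\|}\right\}^{\perp}\cap\ker A_I^{\top}$ such that $\left\|A_{I^C}^{\top}\left(\frac{b-A\bar x}{\|A\bar x-b\|}+z\right)\right\|_\infty<\lambda$. Then $\bar x$ is the unique solution of $\min_{x\in\mathbb{R}^n}\|Ax-b\|+\lambda\|x\|_1$.
   Context: $\|\cdot\|$ is the Euclidean norm, $\|x\|_1=\sum_i|x_i|$, $\|x\|_\infty=\max_i|x_i|$ (equal to $0$ for the empty vector). $\operatorname{supp}(x)=\{i\in\{1,\dots,n\}: x_i\neq0\}$. For $K\subseteq\{1,\dots,n\}$, $A_K$ is the $m\times|K|$ matrix formed by the columns $A_i$ of $A$ with $i\in K$ (for $K=\emptyset$: $\ker A_\emptyset=\{0\}$ and $\operatorname{rge}A_\emptyset=\{0\}$), and $K^C=\{1,\dots,n\}\setminus K$. $\operatorname{rge}$ denotes the range (column space). Note that (i) forces $A\bar x\neq b$, so the expressions in (ii) are well defined. *)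

theory Defs
  imports "HOL-Analysis.Analysis"
begin

definition supp :: "real ^ 'n \<Rightarrow> 'n set" where
  "supp x = {i. x $ i \<noteq> 0}"

definition norm1 :: "real ^ 'n \<Rightarrow> real" where
  "norm1 x = (\<Sum>i\<in>UNIV. \<bar>x $ i\<bar>)"

definition objective :: "real ^ 'n ^ 'm \<Rightarrow> real ^ 'm \<Rightarrow> real \<Rightarrow> real ^ 'n \<Rightarrow> real" where
  "objective A b lam x = norm (A *v x - b) + lam * norm1 x"

definition solutions :: "real ^ 'n ^ 'm \<Rightarrow> real ^ 'm \<Rightarrow> real \<Rightarrow> (real ^ 'n) set" where
  "solutions A b lam = {x. is_arg_min (objective A b lam) (\<lambda>_. True) x}"

text \<open>
  The index set \<open>K\<close> is a term and possibly empty, so the space of real vectors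
  with coordinates in \<open>K\<close> is not a vector type. It is rendered as the set of
  extensional functions on \<open>K\<close>, which is a singleton if \<open>K\<close> is empty. The submatrix
  consisting of the columns \<open>i \<in> K\<close> of \<open>A\<close> enters through its action on such vectors
  and the action of its transpose.
\<close>

definition coord_space :: "'n set \<Rightarrow> ('n \<Rightarrow> real) set" where
  "coord_space K = K \<rightarrow>\<^sub>E UNIV"

definition coord_zero :: "'n set \<Rightarrow> 'n \<Rightarrow> real" where
  "coord_zero K = (\<lambda>i\<in>K. 0)"

definition cols_mult :: "real ^ 'n ^ 'm \<Rightarrow> 'n set \<Rightarrow> ('n \<Rightarrow> real) \<Rightarrow> real ^ 'm" where
  "cols_mult A K u = (\<Sum>i\<in>K. u i *\<^sub>R column i A)"

definition cols_transpose_mult :: "real ^ 'n ^ 'm \<Rightarrow> 'n set \<Rightarrow> real ^ 'm \<Rightarrow> 'n \<Rightarrow> real" where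
  "cols_transpose_mult A K w = (\<lambda>i\<in>K. column i A \<bullet> w)"

definition cols_ker :: "real ^ 'n ^ 'm \<Rightarrow> 'n set \<Rightarrow> ('n \<Rightarrow> real) set" where
  "cols_ker A K = {u \<in> coord_space K. cols_mult A K u = 0}"

definition cols_rge :: "real ^ 'n ^ 'm \<Rightarrow> 'n set \<Rightarrow> (real ^ 'm) set" where
  "cols_rge A K = cols_mult A K ` coord_space K"

definition cols_transpose_ker :: "real ^ 'n ^ 'm \<Rightarrow> 'n set \<Rightarrow> (real ^ 'm) set" where
  "cols_transpose_ker A K = {w. cols_transpose_mult A K w = coord_zero K}"

definition coord_norm_inf :: "'n set \<Rightarrow> ('n \<Rightarrow> real) \<Rightarrow> real" where
  "coord_norm_inf K u = (if K = {} then 0 else Max ((\<lambda>i. \<bar>u i\<bar>) ` K))"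

definition unit_residual :: "real ^ 'n ^ 'm \<Rightarrow> real ^ 'm \<Rightarrow> real ^ 'n \<Rightarrow> real ^ 'm" where
  "unit_residual A b x = (b - A *v x) /\<^sub>R norm (A *v x - b)"

lemma cols_ker_empty: "cols_ker A {} = {coord_zero {}}"
  by (auto simp: cols_ker_def coord_space_def coord_zero_def cols_mult_def)

lemma cols_rge_empty: "cols_rge A {} = {0}"
  by (auto simp: cols_rge_def coord_space_def cols_mult_def)

lemma cols_mult_supp: "cols_mult A (supp x) (restrict (($) x) (supp x)) = A *v x"
proof -
  have "cols_mult A (supp x) (restrict (($) x) (supp x)) = (\<Sum>i\<in>UNIV. x $ i *\<^sub>R column i A)"
    unfolding cols_mult_def by (rule sum.mono_neutral_cong_left) (auto simp: supp_def)
  also have "\<dots> = A *v x"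
    by (simp add: matrix_mult_sum scalar_mult_eq_scaleR)
  finally show ?thesis .
qed

text \<open>The residual in \<^const>\<open>unit_residual\<close> is nonzero under the range condition.\<close>

lemma residual_nonzero:
  assumes "b \<notin> cols_rge A (supp x)"
  shows "A *v x \<noteq> b"
proof
  assume "A *v x = b"
  then have "cols_mult A (supp x) (restrict (($) x) (supp x)) = b"
    by (simp add: cols_mult_supp)
  then show False
    using assms unfolding cols_rge_def coord_space_def by (metis UNIV_I image_eqI restrict_PiE_iff)
qed

end

theory Submission imports Defs begin

text \<open>
  Since both summands of the objective are convex, the residuals of two solutions attain equality in
  the triangle inequality, so every solution has a residual parallel to \<open>b - A xbar\<close>. Hence
  \<open>z\<close> is orthogonal to \<open>A (x - xbar)\<close> for each solution \<open>x\<close>, and \<open>y + z\<close>, with \<open>y\<close> the unit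
  residual, can replace \<open>y\<close> in the subgradient inequality, although its norm may exceed 1.
  Strictness off the support \<open>I\<close> forces \<open>supp x \<subseteq> I\<close>. Now \<open>A (x - xbar)\<close> is a multiple of the
  residual in the range of \<open>A\<^sub>I\<close>, hence zero as \<open>b\<close> is not in this range, and injectivity of
  \<open>A\<^sub>I\<close> gives \<open>x = xbar\<close>.
\<close>

lemma inner_matrix_vector_mult_columns:
  fixes A :: "real ^ 'n ^ 'm"
  shows "w \<bullet> (A *v h) = (\<Sum>i\<in>UNIV. h $ i * (column i A \<bullet> w))"
  by (simp add: matrix_mult_sum scalar_mult_eq_scaleR inner_sum_right inner_commute)

text \<open>\<open>K\<close> may exceed the support of \<open>h\<close>, because vectors such as
  \<open>x - xbar\<close> may vanish at some indices of the support of \<open>xbar\<close>.\<close>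

lemma cols_mult_eq_matrix_vector_mult:
  fixes A :: "real ^ 'n ^ 'm"
  assumes "supp h \<subseteq> K"
  shows "cols_mult A K (restrict (($) h) K) = A *v h"
proof -
  have "cols_mult A K (restrict (($) h) K) = (\<Sum>i\<in>UNIV. h $ i *\<^sub>R column i A)"
    unfolding cols_mult_def using assms
    by (intro sum.mono_neutral_cong_left) (auto simp: supp_def)
  then show ?thesis
    by (simp add: matrix_mult_sum scalar_mult_eq_scaleR)
qed

lemma restrict_in_coord_space: "restrict f K \<in> coord_space K"
  by (simp add: coord_space_def)

lemma matrix_vector_mult_in_cols_rge:
  fixes A :: "real ^ 'n ^ 'm"
  assumes "supp h \<subseteq> K"
  shows "A *v h \<in> cols_rge A K"
  unfolding cols_rge_def
  using cols_mult_eq_matrix_vector_mult[OF assms, of A] restrict_in_coord_space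
  by (metis image_eqI)

lemma cols_ker_trivialD:
  fixes A :: "real ^ 'n ^ 'm"
  assumes "cols_ker A K = {coord_zero K}" "supp h \<subseteq> K" "A *v h = 0"
  shows "h = 0"
proof -
  have "restrict (($) h) K \<in> cols_ker A K"
    using assms(2,3) by (simp add: cols_ker_def restrict_in_coord_space cols_mult_eq_matrix_vector_mult)
  then have *: "restrict (($) h) K = coord_zero K"
    using assms(1) by simp
  have "h $ i = 0" for i
  proof (cases "i \<in> K")
    case True
    then show ?thesis
      using fun_cong[OF *, of i] by (simp add: coord_zero_def)
  qed (use assms(2) in \<open>auto simp: supp_def\<close>)
  then show ?thesis
    by (simp add: vec_eq_iff)
qed

text \<open>Positivity of \<open>c\<close> settles empty \<open>K\<close>, where the norm has the
  default value 0.\<close>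

lemma coord_norm_inf_less_iff:
  fixes K :: "'n::finite set"
  assumes "0 < c"
  shows "coord_norm_inf K u < c \<longleftrightarrow> (\<forall>i\<in>K. \<bar>u i\<bar> < c)"
  using assms by (auto simp: coord_norm_inf_def)

lemma cols_transpose_kerD:
  assumes "z \<in> cols_transpose_ker A K" "i \<in> K"
  shows "column i A \<bullet> z = 0"
proof -
  have "cols_transpose_mult A K z i = coord_zero K i"
    using assms(1) by (simp add: cols_transpose_ker_def)
  then show ?thesis
    using assms(2) by (simp add: cols_transpose_mult_def coord_zero_def)
qed

lemma solutions_iff: "x \<in> solutions A b lam \<longleftrightarrow> (\<forall>y. objective A b lam x \<le> objective A b lam y)"
  by (auto simp: solutions_def is_arg_min_def not_less)

lemma norm1_midpoint_le: "norm1 ((1/2) *\<^sub>R (x + y)) \<le> (norm1 x + norm1 y) / 2"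
proof -
  have "norm1 ((1/2) *\<^sub>R (x + y)) \<le> (\<Sum>i\<in>UNIV. (\<bar>x $ i\<bar> + \<bar>y $ i\<bar>) / 2)"
    unfolding norm1_def by (intro sum_mono) auto
  then show ?thesis
    by (simp add: norm1_def sum.distrib sum_divide_distrib[symmetric])
qed

lemma norm1_add_axis: "norm1 (x + t *\<^sub>R axis i 1) = norm1 x - \<bar>x $ i\<bar> + \<bar>x $ i + t\<bar>"
proof -
  have "norm1 (x + t *\<^sub>R axis i 1) = \<bar>x $ i + t\<bar> + (\<Sum>j\<in>UNIV - {i}. \<bar>x $ j\<bar>)"
    unfolding norm1_def by (subst sum.remove[of _ i]) (auto simp: axis_def)
  moreover have "norm1 x = \<bar>x $ i\<bar> + (\<Sum>j\<in>UNIV - {i}. \<bar>x $ j\<bar>)"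
    unfolding norm1_def by (subst sum.remove[of _ i]) auto
  ultimately show ?thesis by simp
qed

text \<open>The midpoint of two solutions has no smaller objective, while its l1 term is at most
  their average. So the residual norms must add up exactly, which in an inner product space forces
  the residuals to be parallel.\<close>

lemma solutions_residuals_parallel:
  fixes A :: "real ^ 'n ^ 'm"
  assumes "0 \<le> lam" "x \<in> solutions A b lam" "y \<in> solutions A b lam"
  shows "norm (A *v x - b) *\<^sub>R (A *v y - b) = norm (A *v y - b) *\<^sub>R (A *v x - b)"
proof -
  define m where "m = (1/2) *\<^sub>R (x + y)"
  have "A *v m - b = (1/2) *\<^sub>R ((A *v x - b) + (A *v y - b))"
    by (simp add: m_def matrix_vector_mult_scaleR matrix_vector_right_distrib scaleR_diff_right
        scaleR_add_right flip: scaleR_left_distrib)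
  then have m: "norm (A *v m - b) = norm ((A *v x - b) + (A *v y - b)) / 2"
    by simp
  have "lam * norm1 m \<le> lam * ((norm1 x + norm1 y) / 2)"
    unfolding m_def by (intro mult_left_mono norm1_midpoint_le assms(1))
  moreover have "objective A b lam x \<le> objective A b lam m" "objective A b lam y \<le> objective A b lam m"
    using assms(2,3) by (auto simp: solutions_iff)
  ultimately have "norm (A *v x - b) + norm (A *v y - b) \<le> norm ((A *v x - b) + (A *v y - b))"
    unfolding objective_def m by (simp add: field_simps)
  then have "norm ((A *v x - b) + (A *v y - b)) = norm (A *v x - b) + norm (A *v y - b)"
    by (intro antisym norm_triangle_ineq)
  then show ?thesis
    by (simp only: norm_triangle_eq)
qed

text \<open>Fermat's rule along the \<open>i\<close>-th axis: the objective is differentiable there,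
  since neither the residual nor \<open>x $ i\<close> vanishes.\<close>

lemma solutions_column_inner_unit_residual:
  fixes A :: "real ^ 'n ^ 'm"
  assumes "x \<in> solutions A b lam" "A *v x \<noteq> b" "i \<in> supp x"
  shows "column i A \<bullet> unit_residual A b x = lam * sgn (x $ i)"
proof -
  define f where "f t = norm (A *v x - b + t *\<^sub>R column i A) + lam * (norm1 x - \<bar>x $ i\<bar> + \<bar>x $ i + t\<bar>)" for t
  have f: "f t = objective A b lam (x + t *\<^sub>R axis i 1)" for t
    by (simp add: f_def objective_def norm1_add_axis matrix_vector_right_distrib
        matrix_vector_mult_scaleR matrix_vector_mult_basis algebra_simps)
  define d where "d = sgn (A *v x - b) \<bullet> column i A + lam * sgn (x $ i)"
  have "(f has_derivative (\<lambda>h. d * h)) (at 0)"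
  proof -
    have 1: "((\<lambda>t. norm (A *v x - b + t *\<^sub>R column i A)) has_derivative
        (\<lambda>h. (h *\<^sub>R column i A) \<bullet> sgn (A *v x - b))) (at 0)"
    proof (rule has_derivative_compose[where g = norm])
      show "((\<lambda>t. A *v x - b + t *\<^sub>R column i A) has_derivative (\<lambda>h. h *\<^sub>R column i A)) (at 0)"
        by (auto intro!: derivative_eq_intros)
      show "(norm has_derivative (\<lambda>v. v \<bullet> sgn (A *v x - b))) (at (A *v x - b + 0 *\<^sub>R column i A))"
        using has_derivative_norm[of "A *v x - b"] assms(2) by simp
    qed
    have 2: "((\<lambda>t. \<bar>x $ i + t\<bar>) has_derivative (\<lambda>h. h * sgn (x $ i))) (at 0)"
    proof (rule has_derivative_compose[where g = abs and f' = "\<lambda>h. h"])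
      show "((\<lambda>t. x $ i + t) has_derivative (\<lambda>h. h)) (at 0)"
        by (auto intro!: derivative_eq_intros)
      show "(abs has_derivative (\<lambda>h. h * sgn (x $ i))) (at (x $ i + 0))"
        using has_derivative_norm[of "x $ i"] assms(3) by (simp add: supp_def mult.commute real_norm_def[abs_def])
    qed
    show ?thesis
      unfolding f_def
      by (rule has_derivative_eq_rhs[OF has_derivative_add[OF 1
              has_derivative_mult_right[OF has_derivative_add[OF has_derivative_const 2]]]])
        (simp add: d_def fun_eq_iff inner_commute algebra_simps)
  qed
  then have "(f has_field_derivative d) (at 0)"
    by (simp add: has_field_derivative_def)
  then have "d = 0"
  proof (rule DERIV_local_min)
    show "\<forall>t. \<bar>0 - t\<bar> < 1 \<longrightarrow> f 0 \<le> f t"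
      using assms(1) by (simp add: f solutions_iff)
  qed simp
  \<comment> \<open>The unit residual points from \<open>A *v x\<close> to \<open>b\<close>,
    opposite to the gradient of the norm.\<close>
  moreover have "unit_residual A b x = - sgn (A *v x - b)"
    by (simp add: unit_residual_def sgn_div_norm flip: scaleR_minus_right)
  ultimately show ?thesis
    by (simp add: d_def inner_commute)
qed

theorem theorem3p4:
  fixes A :: "real ^ 'n ^ 'm" and b :: "real ^ 'm" and lam :: real and xbar :: "real ^ 'n"
  assumes "lam > 0"
    and "xbar \<in> solutions A b lam"
    and "cols_ker A (supp xbar) = {coord_zero (supp xbar)}"
    and "b \<notin> cols_rge A (supp xbar)"
    and "\<exists>z \<in> orthogonal_comp {unit_residual A b xbar} \<inter> cols_transpose_ker A (supp xbar).
           coord_norm_inf (- supp xbar)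
             (cols_transpose_mult A (- supp xbar) (unit_residual A b xbar + z)) < lam"
  shows "solutions A b lam = {xbar}"
proof -
  define I where "I = supp xbar"
  define y where "y = unit_residual A b xbar"
  define rho where "rho = norm (A *v xbar - b)"
  have ne: "A *v xbar \<noteq> b"
    using assms(4) by (rule residual_nonzero)
  then have rho: "rho > 0"
    by (simp add: rho_def)
  have res: "A *v xbar - b = - rho *\<^sub>R y"
    using rho by (simp add: y_def unit_residual_def rho_def)
  have norm_y: "norm y = 1"
    using rho by (simp add: y_def unit_residual_def rho_def norm_minus_commute)
  obtain z where z: "z \<in> orthogonal_comp {y}" "z \<in> cols_transpose_ker A I"
    and less: "coord_norm_inf (- I) (cols_transpose_mult A (- I) (y + z)) < lam"
    using assms(5) unfolding I_def y_def by blast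
  have zy: "z \<bullet> y = 0"
    using z(1) by (simp add: orthogonal_comp_def orthogonal_def inner_commute)
  \<comment> \<open>The dual certificate: \<open>q\<close> is \<open>lam\<close> times a subgradient
    of the l1 norm at \<open>xbar\<close>. On \<open>I\<close> the vector \<open>z\<close>
    contributes nothing, and off \<open>I\<close> the bound is strict.\<close>
  define q where "q i = column i A \<bullet> (y + z)" for i
  have q_in: "q i = lam * sgn (xbar $ i)" if "i \<in> I" for i
    using that solutions_column_inner_unit_residual[OF assms(2) ne] cols_transpose_kerD[OF z(2)]
    by (simp add: q_def inner_add_right I_def y_def)
  have q_out: "\<bar>q i\<bar> < lam" if "i \<notin> I" for i
    using that less by (simp add: coord_norm_inf_less_iff[OF assms(1)] cols_transpose_mult_def q_def)
  have "x = xbar" if x: "x \<in> solutions A b lam" for x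
  proof -
    define h where "h = x - xbar"
    have Ah: "A *v h = (A *v x - b) - (A *v xbar - b)"
      by (simp add: h_def matrix_vector_mult_diff_distrib)
    \<comment> \<open>Both residuals are nonpositive multiples of \<open>y\<close>, so the decrease
      \<open>c\<close> of the residual norm is the coefficient in
      \<open>A *v h = c *\<^sub>R y\<close>.\<close>
    define c where "c = rho - norm (A *v x - b)"
    have "rho *\<^sub>R (A *v x - b) = norm (A *v x - b) *\<^sub>R (A *v xbar - b)"
      using solutions_residuals_parallel[OF _ assms(2) x] assms(1) by (simp add: rho_def)
    then have "rho *\<^sub>R (A *v x - b) = rho *\<^sub>R (- norm (A *v x - b) *\<^sub>R y)"
      by (simp add: res)
    then have "A *v x - b = - norm (A *v x - b) *\<^sub>R y"
      using rho by (metis less_irrefl scaleR_cancel_left)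
    then have Ah_y: "A *v h = c *\<^sub>R y"
      unfolding Ah res c_def by (simp add: scaleR_diff_left)
    have "c = (y + z) \<bullet> (A *v h)"
      using norm_y by (simp add: Ah_y inner_add_left zy flip: power2_norm_eq_inner)
    then have c_sum: "c = (\<Sum>i\<in>UNIV. q i * h $ i)"
      by (simp add: inner_matrix_vector_mult_columns q_def mult.commute)
    \<comment> \<open>Equal optimal values make \<open>c\<close> also the increase of the l1
      penalty. Subtracting its two expressions leaves a sum of coordinatewise gaps equal to
      zero.\<close>
    have "objective A b lam x = objective A b lam xbar"
      using x assms(2) by (simp add: solutions_iff antisym)
    then have "c = lam * (norm1 x - norm1 xbar)"
      by (simp add: objective_def c_def rho_def algebra_simps)
    then have sum0: "(\<Sum>i\<in>UNIV. lam * \<bar>x $ i\<bar> - lam * \<bar>xbar $ i\<bar> - q i * h $ i) = 0"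
      by (simp add: c_sum norm1_def sum_subtractf right_diff_distrib sum_distrib_left)
    \<comment> \<open>This is the subgradient inequality for \<open>lam\<close> times the absolute
      value at \<open>xbar $ i\<close>, with slope \<open>q i\<close>.\<close>
    have nonneg: "0 \<le> lam * \<bar>x $ i\<bar> - lam * \<bar>xbar $ i\<bar> - q i * h $ i" for i
    proof (cases "i \<in> I")
      case True
      have "0 \<le> lam * (\<bar>x $ i\<bar> - \<bar>xbar $ i\<bar> - sgn (xbar $ i) * (x $ i - xbar $ i))"
        using assms(1) by (intro mult_nonneg_nonneg) (auto simp: sgn_if)
      then show ?thesis
        using q_in[OF True] by (simp add: h_def algebra_simps)
    next
      case False
      have "q i * x $ i \<le> \<bar>q i\<bar> * \<bar>x $ i\<bar>"
        by (metis abs_ge_self abs_mult)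
      also have "\<dots> \<le> lam * \<bar>x $ i\<bar>"
        using q_out[OF False] by (intro mult_right_mono) auto
      finally show ?thesis
        using False by (simp add: h_def I_def supp_def)
    qed
    have zero: "lam * \<bar>x $ i\<bar> - lam * \<bar>xbar $ i\<bar> - q i * h $ i = 0" for i
      using sum0 nonneg by (simp add: sum_nonneg_eq_0_iff)
    \<comment> \<open>Off \<open>I\<close> the vanishing gap reads
      \<open>lam * \<bar>x $ i\<bar> = q i * x $ i\<close>, which a slope strictly below
      \<open>lam\<close> in absolute value permits only at 0.\<close>
    have x_out: "x $ i = 0" if "i \<notin> I" for i
    proof (rule ccontr)
      assume "x $ i \<noteq> 0"
      then have "\<bar>q i\<bar> * \<bar>x $ i\<bar> < lam * \<bar>x $ i\<bar>"
        using q_out[OF that] by (intro mult_strict_right_mono) auto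
      moreover have "q i * x $ i \<le> \<bar>q i\<bar> * \<bar>x $ i\<bar>"
        by (metis abs_ge_self abs_mult)
      ultimately show False
        using zero[of i] that by (simp add: h_def I_def supp_def)
    qed
    then have supp_h: "supp h \<subseteq> I"
      by (auto simp: supp_def h_def I_def)
    have "c = 0"
    proof (rule ccontr)
      assume "c \<noteq> 0"
      \<comment> \<open>The step length \<open>rho / c\<close> along \<open>h\<close> adds
        \<open>rho *\<^sub>R y\<close>, cancelling the residual of \<open>xbar\<close> without
        leaving the coordinates in \<open>I\<close>.\<close>
      then have "A *v (xbar + (rho / c) *\<^sub>R h) = b"
        using res by (simp add: matrix_vector_right_distrib matrix_vector_mult_scaleR Ah_y algebra_simps)
      moreover have "supp (xbar + (rho / c) *\<^sub>R h) \<subseteq> I"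
        using supp_h by (auto simp: supp_def I_def)
      ultimately show False
        using assms(4) matrix_vector_mult_in_cols_rge unfolding I_def by metis
    qed
    then have "h = 0"
      using cols_ker_trivialD[OF assms(3), of h] supp_h Ah_y by (simp add: I_def)
    then show ?thesis
      by (simp add: h_def)
  qed
  then show ?thesis
    using assms(2) by blast
qed

end
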